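(* Let $F$ be a field with $\operatorname{char}(F)\neq 2,3$ and let $A$ be a commutator-simple unital algebra over $F$. If a surjective linear map $T\colon A\to A$ satisfies $T(1)=1$ and $T(x)^3-x^3\in[A,A]$ for every $x\in A$, then $T$ is a Jordan homomorphism, i.e., $T(x^2)=T(x)^2$ for every $x\in A$.
   Context: Algebras are associative; ideals are two-sided. For an algebra $A$, $[x,y]=xy-yx$ and $[A,A]$ denotes the linear span of all commutators $[x,y]$ with $x,y\in A$. An algebra $A$ is commutator-simple if $[A,A]$ does not contain nonzero ideals of $A$. *)

theory Defs
  imports Complex_Main
begin

text \<open>
  Associative unital algebras over a field. The sort \<open>{ring, monoid_mult}\<close> is that of
  associative rings with unit, without the axiom \<open>0 \<noteq> 1\<close> of \<^class>\<open>ring_1\<close>,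
  so the zero algebra is not excluded.
\<close>

locale unital_algebra = vector_space scale
  for scale :: "'f::field \<Rightarrow> 'a::{ring, monoid_mult} \<Rightarrow> 'a" (infixr \<open>*s\<close> 75) +
  assumes scale_mult_left: "(c *s x) * y = c *s (x * y)"
    and scale_mult_right: "x * (c *s y) = c *s (x * y)"
begin

definition commutator_span :: "'a set"
  where "commutator_span = span {x * y - y * x | x y. True}"

definition two_sided_ideal :: "'a set \<Rightarrow> bool"
  where "two_sided_ideal I \<longleftrightarrow>
    subspace I \<and> (\<forall>a. \<forall>x\<in>I. a * x \<in> I \<and> x * a \<in> I)"

definition commutator_simple :: bool
  where "commutator_simple \<longleftrightarrow>
    (\<forall>I. two_sided_ideal I \<and> I \<subseteq> commutator_span \<longrightarrow> I = {0})"

definition jordan_hom :: "('a \<Rightarrow> 'a) \<Rightarrow> bool"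
  where "jordan_hom T \<longleftrightarrow>
    Vector_Spaces.linear scale scale T \<and> (\<forall>x. T (x ^ 2) = T x ^ 2)"

end

end

(*
Write a == b for a - b in [A,A]. The elements a with aA inside [A,A] form an ideal contained in
[A,A], so they vanish: the form (a, b) |-> ab mod [A,A] is nondegenerate. Polarizing
T(x)^3 == x^3 gives T(x)^2 T(y) == x^2 y; putting y = 1 and polarizing again gives
T(x) T(y) == xy. Hence T(x)^2 T(y) == x^2 y == T(x^2) T(y), and surjectivity of T together with
nondegeneracy yields T(x)^2 = T(x^2).
*)
theory Submission
  imports Defs "HOL-Computational_Algebra.Primes"
begin

text \<open>If \<open>of_nat p\<close> vanishes, the characteristic divides \<open>p\<close>, so it
  is 1 or \<open>p\<close>; a field excludes 1 because \<open>1 \<noteq> 0\<close>.\<close>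

lemma of_nat_prime_eq_0_iff_CHAR:
  assumes "prime p"
  shows "(of_nat p :: 'f::field) = 0 \<longleftrightarrow> CHAR('f) = p"
  using assms by (auto simp: of_nat_eq_0_iff_char_dvd prime_nat_iff)

context unital_algebra
begin

lemma subspace_commutator_span: "subspace commutator_span"
  by (simp add: commutator_span_def)

lemmas commutator_span_add = subspace_add[OF subspace_commutator_span]
  and commutator_span_diff = subspace_diff[OF subspace_commutator_span]
  and commutator_span_scale = subspace_scale[OF subspace_commutator_span]

lemma commutator_in_commutator_span: "x * y - y * x \<in> commutator_span"
  unfolding commutator_span_def by (rule span_base) blast

text \<open>Replacing integer scalars by repeated sums turns the polarization formulas into plain
  ring identities, within reach of \<open>algebra_simps\<close>.\<close>

lemma scale_of_nat_2: "of_nat 2 *s x = x + x"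
  using scale_left_distrib[of 1 1 x] by simp

lemma scale_of_nat_6: "of_nat 6 *s x = (x + x) + (x + x) + (x + x)"
proof -
  have "of_nat 6 = (of_nat 2 + of_nat 2 + of_nat 2 :: 'f)"
    by (simp only: of_nat_add[symmetric]) simp
  then show ?thesis
    by (simp only: scale_left_distrib scale_of_nat_2)
qed

lemma commutator_span_scaleD:
  assumes "c *s x \<in> commutator_span" and "c \<noteq> 0"
  shows "x \<in> commutator_span"
  using commutator_span_scale[OF assms(1), of "inverse c"] assms(2) by simp

lemma eq_0_if_all_mult_in_commutator_span:
  assumes "commutator_simple" and "\<And>x. a * x \<in> commutator_span"
  shows "a = 0"
proof -
  let ?R = "{a. \<forall>x. a * x \<in> commutator_span}"
  have "subspace ?R"
    by (rule subspaceI)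
      (auto simp: distrib_right scale_mult_left
        intro: commutator_span_add commutator_span_scale subspace_0[OF subspace_commutator_span])
  moreover have "b * a * x \<in> commutator_span" if "a \<in> ?R" for a b x
  proof -
    \<comment> \<open>Cyclicity: moving \<open>b\<close> from the front to the end costs one
      commutator. This makes \<open>?R\<close> closed under left multiplication; right
      multiplication needs only associativity.\<close>
    have "b * a * x = a * (x * b) + (b * (a * x) - (a * x) * b)"
      by (simp add: mult.assoc)
    with that show ?thesis
      by (auto intro: commutator_span_add commutator_in_commutator_span)
  qed
  ultimately have "two_sided_ideal ?R"
    by (auto simp: two_sided_ideal_def mult.assoc)
  moreover have "?R \<subseteq> commutator_span"
    by (auto dest: spec[of _ 1])
  ultimately have "?R = {0}"
    using assms(1) unfolding commutator_simple_def by blast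
  then show ?thesis
    using assms(2) by blast
qed

text \<open>In the difference of cubes only the words of odd degree in \<open>b\<close> survive,
  each doubled. Modulo commutators \<open>a * a * b\<close>, \<open>a * b * a\<close> and
  \<open>b * a * a\<close> agree, being cyclic rotations, whence the factor 6.\<close>

lemma cube_polarization:
  "(a + b) ^ 3 - (a - b) ^ 3 - of_nat 2 *s b ^ 3 - of_nat 6 *s (a ^ 2 * b) \<in> commutator_span"
proof -
  \<comment> \<open>The error is \<open>2aba + 2baa - 4aab\<close>; with
    \<open>?c = baa - aab\<close> and \<open>?d = baa - aba\<close> it equals
    \<open>4?c - 2?d\<close>.\<close>
  let ?c = "b * (a * a) - (a * a) * b" and ?d = "(b * a) * a - a * (b * a)"
  have "(a + b) ^ 3 - (a - b) ^ 3 - of_nat 2 *s b ^ 3 - of_nat 6 *s (a ^ 2 * b)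
      = (?c + ?c + ?c + ?c) - (?d + ?d)"
    by (simp add: power3_eq_cube power2_eq_square scale_of_nat_2 scale_of_nat_6 algebra_simps
        del: of_nat_numeral)
  also have "\<dots> \<in> commutator_span"
    by (intro commutator_span_add commutator_span_diff commutator_in_commutator_span)
  finally show ?thesis .
qed

lemma square_polarization:
  "(a + b) ^ 2 - a ^ 2 - b ^ 2 - of_nat 2 *s (a * b) \<in> commutator_span"
proof -
  have "(a + b) ^ 2 - a ^ 2 - b ^ 2 - of_nat 2 *s (a * b) = b * a - a * b"
    by (simp add: power2_eq_square scale_of_nat_2 algebra_simps del: of_nat_numeral)
  then show ?thesis
    by (simp add: commutator_in_commutator_span)
qed

context
  fixes T :: "'a \<Rightarrow> 'a"
  assumes CHAR_neq_2: "CHAR('f) \<noteq> 2" and CHAR_neq_3: "CHAR('f) \<noteq> 3"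
    and linear_T: "Vector_Spaces.linear scale scale T"
    and T_1: "T 1 = 1"
    and T_cube: "T x ^ 3 - x ^ 3 \<in> commutator_span"
begin

interpretation T: Vector_Spaces.linear scale scale T
  by (fact linear_T)

lemma T_square_mult: "T x ^ 2 * T y - x ^ 2 * y \<in> commutator_span"
proof -
  let ?p = "\<lambda>a b. (a + b) ^ 3 - (a - b) ^ 3 - of_nat 2 *s b ^ 3 - of_nat 6 *s (a ^ 2 * b)"
  \<comment> \<open>By linearity, \<open>T\<close> carries \<open>x + y\<close> and
    \<open>x - y\<close> to \<open>T x + T y\<close> and \<open>T x - T y\<close>, so the hypothesis
    on cubes applies to both and to \<open>y\<close>.\<close>
  have "of_nat 6 *s (T x ^ 2 * T y - x ^ 2 * y)
      = (T (x + y) ^ 3 - (x + y) ^ 3) - (T (x - y) ^ 3 - (x - y) ^ 3)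
        - of_nat 2 *s (T y ^ 3 - y ^ 3) - (?p (T x) (T y) - ?p x y)"
    by (simp add: T.add T.diff scale_right_diff_distrib del: of_nat_numeral)
  also have "\<dots> \<in> commutator_span"
    by (intro commutator_span_diff commutator_span_scale T_cube cube_polarization)
  finally have *: "of_nat 6 *s (T x ^ 2 * T y - x ^ 2 * y) \<in> commutator_span" .
  \<comment> \<open>Cancelling 6 is where both restrictions on the characteristic enter.\<close>
  have "(of_nat 6 :: 'f) = of_nat 2 * of_nat 3"
    by (simp only: of_nat_mult[symmetric]) simp
  then have "(of_nat 6 :: 'f) \<noteq> 0"
    using of_nat_prime_eq_0_iff_CHAR[where 'f = 'f, of 2]
      of_nat_prime_eq_0_iff_CHAR[where 'f = 'f, of 3] CHAR_neq_2 CHAR_neq_3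
    by (simp del: of_nat_numeral)
  with * show ?thesis
    by (rule commutator_span_scaleD)
qed

lemma T_mult: "T x * T y - x * y \<in> commutator_span"
proof -
  let ?p = "\<lambda>a b. (a + b) ^ 2 - a ^ 2 - b ^ 2 - of_nat 2 *s (a * b)"
  \<comment> \<open>Since \<open>T 1 = 1\<close>, taking \<open>y = 1\<close> lowers the degree from
    three to two.\<close>
  have T_square: "T z ^ 2 - z ^ 2 \<in> commutator_span" for z
    using T_square_mult[of z 1] by (simp add: T_1)
  have "of_nat 2 *s (T x * T y - x * y)
      = (T (x + y) ^ 2 - (x + y) ^ 2) - (T x ^ 2 - x ^ 2) - (T y ^ 2 - y ^ 2)
        - (?p (T x) (T y) - ?p x y)"
    by (simp add: T.add scale_right_diff_distrib del: of_nat_numeral)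
  also have "\<dots> \<in> commutator_span"
    by (intro commutator_span_diff T_square square_polarization)
  finally have "of_nat 2 *s (T x * T y - x * y) \<in> commutator_span" .
  moreover have "(of_nat 2 :: 'f) \<noteq> 0"
    using of_nat_prime_eq_0_iff_CHAR[where 'f = 'f, of 2] CHAR_neq_2 by simp
  ultimately show ?thesis
    by (rule commutator_span_scaleD)
qed

lemma jordan_hom_if_surj:
  assumes "commutator_simple" and "surj T"
  shows "jordan_hom T"
proof -
  have "T x ^ 2 - T (x ^ 2) = 0" for x
  proof (rule eq_0_if_all_mult_in_commutator_span[OF assms(1)])
    fix z
    obtain y where z: "z = T y"
      using assms(2) by (rule surjE)
    \<comment> \<open>Both products are congruent to \<open>x ^ 2 * y\<close>: the first by
      \<open>T_square_mult\<close>, the second by \<open>T_mult\<close> at \<open>x ^ 2\<close> and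
      \<open>y\<close>.\<close>
    have "(T x ^ 2 - T (x ^ 2)) * z
        = (T x ^ 2 * T y - x ^ 2 * y) - (T (x ^ 2) * T y - x ^ 2 * y)"
      by (simp add: z left_diff_distrib)
    also have "\<dots> \<in> commutator_span"
      by (intro commutator_span_diff T_square_mult T_mult)
    finally show "(T x ^ 2 - T (x ^ 2)) * z \<in> commutator_span" .
  qed
  then show ?thesis
    using linear_T by (simp add: jordan_hom_def)
qed

end

end

theorem theorem4p1:
  fixes scale :: "'f::field \<Rightarrow> 'a::{ring, monoid_mult} \<Rightarrow> 'a"
    and T :: "'a \<Rightarrow> 'a"
  assumes "CHAR('f) \<noteq> 2" and "CHAR('f) \<noteq> 3"
    and "unital_algebra scale"
    and "unital_algebra.commutator_simple scale"
    and "Vector_Spaces.linear scale scale T"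
    and "surj T"
    and "T 1 = 1"
    and "\<And>x. T x ^ 3 - x ^ 3 \<in> unital_algebra.commutator_span scale"
  shows "unital_algebra.jordan_hom scale T"
  using assms by (intro unital_algebra.jordan_hom_if_surj)

end
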